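(* Let $\lambda > 0$ and let $(X_n)_{n\in\mathbb{Z}}$ be a sequence of i.i.d. random variables uniformly distributed in $[0,\lambda]$. Put $x_n = n\lambda + X_n$ for $n \in \mathbb{Z}$. Then almost every configuration $\{x_n\}_{n\in\mathbb{Z}}$ of this point process has the following property: if $f$ is any function in the linear chirp space $\mathcal{LC}$ satisfying $$f(x_n) = 0 \qquad \text{for all } n \in \mathbb{Z},$$ then $f \equiv 0$. (That is, with probability one, the implication holds simultaneously for all $f \in \mathcal{LC}$.)
   Context: The space $\mathcal{LC}$ of linear chirp functions is the set of functions $f:\mathbb{R}\to\mathbb{C}$ such that for every $\varepsilon > 0$ there exist a finite number $k$, real numbers $\omega_j, c_j, \alpha_j$ and complex coefficients $B_j$ ($1 \le j \le k$) such that the function $$g(x) = \sum_{j=1}^{k} B_j e^{i\{\omega_j + c_j(x-\alpha_j)\}x}$$ satisfies $$\sup_{x\in\mathbb{R}} |f(x) - g(x)| \le \varepsilon .$$ (The case where all $c_j = 0$ corresponds to the space of complex almost periodic functions.) *)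

theory Defs
  imports "HOL-Probability.Probability"
begin

definition linear_chirp_space :: "(real \<Rightarrow> complex) set" where
  "linear_chirp_space =
     {f. \<forall>\<epsilon>>0. \<exists>(k::nat) (\<omega> :: nat \<Rightarrow> real) (c :: nat \<Rightarrow> real) (\<alpha> :: nat \<Rightarrow> real) (B :: nat \<Rightarrow> complex).
          \<forall>x::real. cmod (f x - (\<Sum>j=1..k. B j *
              exp (\<i> * complex_of_real ((\<omega> j + c j * (x - \<alpha> j)) * x)))) \<le> \<epsilon>}"

end

theory Submission
  imports Defs "HOL-Real_Asymp.Real_Asymp"
begin

text \<open>
  Up to a change of parameters the generators of the chirp space are the chirps
  \<open>e\<^sub>a\<^sub>,\<^sub>c(x) = exp(i(ax + cx\<^sup>2))\<close>, which form a group under multiplication. The proof shows that almost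
  surely the averages of \<^emph>\<open>every\<close> nontrivial chirp along the points \<open>x\<^sub>0, x\<^sub>1, x\<^sub>2, \<dots>\<close> tend to \<open>0\<close>
  (Weyl's criterion), and that a sequence with this property is a uniqueness set for the
  chirp space.

  The second half is deterministic. A Kronecker-type argument (\<open>averages_recurrence\<close>)
  shows that finitely many chirps simultaneously come close, at some point of the sequence, to
  the values that they take at any prescribed real \<open>y\<close>. A chirp polynomial that is uniformly
  close to \<open>f\<close> therefore takes almost its value at \<open>y\<close> at some point \<open>x\<^sub>n\<close>, so that \<open>f(x\<^sub>n) = 0\<close> for
  all \<open>n\<close> forces \<open>f(y) = 0\<close> (\<open>chirp_space_zero_on_equidistributed\<close>).

  For the first half, the expectation of \<open>e\<^sub>a\<^sub>,\<^sub>c(x\<^sub>n)\<close> is the mean of the chirp over the cell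
  \<open>[n\<lambda>, (n+1)\<lambda>]\<close>, so the averaged expectations are means of the chirp over the long
  intervals \<open>[0, N\<lambda>]\<close>, which tend to \<open>0\<close> by oscillation (\<open>chirp_mean_tendsto_0\<close>). The deviations from
  the expectations tend to \<open>0\<close> almost surely and simultaneously for all \<open>(a, c)\<close>
  (\<open>AE_chirp_deviation_tendsto_0\<close>): for the first \<open>N\<close> points the parameters matter only up to
  precision \<open>N\<^sup>-\<^sup>3\<close>, so it suffices to control polynomially many of them, each of which misbehaves
  with exponentially small probability by Hoeffding's inequality.
\<close>

section \<open>Chirps\<close>

definition chirp :: "real \<Rightarrow> real \<Rightarrow> real \<Rightarrow> complex" where
  "chirp a c x = cis (a * x + c * x\<^sup>2)"

lemma norm_chirp [simp]: "cmod (chirp a c x) = 1"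
  by (simp add: chirp_def)

lemma chirp_0_0 [simp]: "chirp 0 0 x = 1"
  by (simp add: chirp_def)

lemma continuous_on_chirp: "continuous_on A (chirp a c)"
  unfolding chirp_def cis_conv_exp by (intro continuous_intros)

lemma chirp_borel_measurable [measurable]: "chirp a c \<in> borel_measurable borel"
  by (rule borel_measurable_continuous_onI[OF continuous_on_chirp])

lemma norm_cis_diff: "cmod (cis s - cis t) = 2 * \<bar>sin ((s - t) / 2)\<bar>"
proof -
  have "cis s - cis t = cis t * (cis (s - t) - 1)"
    by (simp add: cis_mult algebra_simps)
  then have "cmod (cis s - cis t) = cmod (cis (s - t) - 1)"
    by (simp add: norm_mult)
  also have "\<dots> = 2 * \<bar>sin ((s - t) / 2)\<bar>"
    using dist_exp_i_1[of "s - t"] by (simp add: cis_conv_exp)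
  finally show ?thesis .
qed

lemma norm_chirp_diff_le:
  "cmod (chirp a c x - chirp a' c' x) \<le> \<bar>a - a'\<bar> * \<bar>x\<bar> + \<bar>c - c'\<bar> * x\<^sup>2"
proof -
  have "cmod (chirp a c x - chirp a' c' x) \<le> \<bar>(a * x + c * x\<^sup>2) - (a' * x + c' * x\<^sup>2)\<bar>"
    unfolding chirp_def norm_cis_diff
    using abs_sin_le_one abs_sin_x_le_abs_x[of "((a * x + c * x\<^sup>2) - (a' * x + c' * x\<^sup>2)) / 2"] by simp
  also have "\<dots> = \<bar>(a - a') * x + (c - c') * x\<^sup>2\<bar>"
    by (simp add: algebra_simps)
  also have "\<dots> \<le> \<bar>(a - a') * x\<bar> + \<bar>(c - c') * x\<^sup>2\<bar>"
    by (rule abs_triangle_ineq)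
  finally show ?thesis by (simp add: abs_mult)
qed

text \<open>The shift \<open>\<alpha>\<close> of a chirp is absorbed into its linear frequency, so chirps are
  parametrised by the two coefficients of a quadratic phase without constant term. In this
  form they are closed under multiplication and conjugation.\<close>
lemma chirp_term_eq:
  "exp (\<i> * complex_of_real ((\<omega> + c * (x - \<alpha>)) * x)) = chirp (\<omega> - c * \<alpha>) c x"
  by (simp add: chirp_def cis_conv_exp algebra_simps power2_eq_square)

section \<open>Recurrence along sequences with vanishing chirp averages\<close>

text \<open>The non-negative function \<open>cos\<^sup>2\<^sup>m (t/2)\<close> is concentrated around the multiples of \<open>2\<pi>\<close>.
  Its Fourier coefficients are non-negative, and the constant one (\<open>s = m\<close>) decays
  only like a power of \<open>m\<close>.\<close>
lemma cos_power_Fourier: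
  "complex_of_real (cos (t / 2) ^ (2 * m)) =
     (\<Sum>s\<le>2*m. of_real (real ((2 * m) choose s) / 4 ^ m) * cis ((real s - real m) * t))"
proof -
  have "complex_of_real (cos (t / 2)) = (cis (t / 2) + cis (- (t / 2))) / 2"
    by (simp add: complex_eq_iff)
  then have "complex_of_real (cos (t / 2) ^ (2 * m)) = (cis (t / 2) + cis (- (t / 2))) ^ (2 * m) / 2 ^ (2 * m)"
    by (simp only: of_real_power power_divide)
  also have "(cis (t / 2) + cis (- (t / 2))) ^ (2 * m) =
      (\<Sum>s\<le>2*m. of_nat ((2 * m) choose s) * cis (t / 2) ^ s * cis (- (t / 2)) ^ (2 * m - s))"
    by (rule binomial_ring)
  also have "\<dots> = (\<Sum>s\<le>2*m. of_nat ((2 * m) choose s) * cis ((real s - real m) * t))"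
  proof (intro sum.cong refl)
    fix s assume "s \<in> {..2*m}"
    then have "cis (t / 2) ^ s * cis (- (t / 2)) ^ (2 * m - s) = cis ((real s - real m) * t)"
      unfolding Complex.DeMoivre cis_mult
      by (intro arg_cong[of _ _ cis]) (simp add: of_nat_diff field_simps)
    then show "of_nat ((2 * m) choose s) * cis (t / 2) ^ s * cis (- (t / 2)) ^ (2 * m - s) =
        of_nat ((2 * m) choose s) * cis ((real s - real m) * t)"
      by (simp add: mult.assoc)
  qed
  finally show ?thesis
    by (simp add: sum_divide_distrib power_mult)
qed

text \<open>This is Kronecker's argument with the product \<open>K\<close> of the kernels
  \<open>cos\<^sup>2\<^sup>m (\<psi>\<^sub>j/2)\<close>, where \<open>\<psi>\<^sub>j\<close> is the \<open>j\<close>-th phase relative to its value at \<open>y\<close>. If at each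
  \<open>x\<^sub>n\<close> some phase stays away from \<open>0\<close>, then \<open>K \<le> q\<^sup>m\<close> at all these points, with
  \<open>q < 1\<close> independent of \<open>m\<close>. On the other hand \<open>K\<close> is a linear combination of chirps, so its
  average along \<open>x\<^sub>n\<close> tends to the total coefficient of the constant chirp. Linear relations
  between the phases only add further non-negative terms to it, because a combination of the
  \<open>\<psi>\<^sub>j\<close> whose coefficients cancel vanishes at \<open>y\<close> too; hence the average is at least of the
  order of a fixed power of \<open>1/m\<close>. The two bounds conflict for large \<open>m\<close>.\<close>
lemma averages_recurrence:
  fixes x :: "nat \<Rightarrow> real" and a c :: "'j \<Rightarrow> real"
  assumes avg: "\<And>a c. (a, c) \<noteq> (0, 0) \<Longrightarrow> (\<lambda>N. (\<Sum>n<N. chirp a c (x n)) / of_nat N) \<longlonglongrightarrow> 0"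
    and J: "finite J" and \<eta>: "\<eta> > 0"
  shows "\<exists>n. \<forall>j\<in>J. cmod (chirp (a j) (c j) (x n) - chirp (a j) (c j) y) < \<eta>"
proof (rule ccontr)
  assume "\<not> ?thesis"
  then have far: "\<exists>j\<in>J. cmod (chirp (a j) (c j) (x n) - chirp (a j) (c j) y) \<ge> \<eta>" for n
    by (auto simp: not_less)
  define \<psi> where "\<psi> j t = (a j * t + c j * t\<^sup>2) - (a j * y + c j * y\<^sup>2)" for j t
  define K where "K m t = (\<Prod>j\<in>J. cos (\<psi> j t / 2) ^ (2 * m))" for m t
  \<comment> \<open>If a chirp is at distance at least \<open>\<eta>\<close> from its value at \<open>y\<close>, then
    \<open>2 \<bar>sin (\<psi>/2)\<bar> \<ge> \<eta>\<close>, that is \<open>cos\<^sup>2 (\<psi>/2) \<le> 1 - \<eta>\<^sup>2/4\<close>; the minimum keeps \<open>q\<close> positive.\<close>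
  define q where "q = 1 - (min \<eta> 1)\<^sup>2 / 4"
  have q: "0 < q" "q < 1"
    using \<eta> power_mono[of "min \<eta> 1" 1 2] by (auto simp: q_def)
  have K_le: "K m (x n) \<le> q ^ m" for m n
  proof -
    obtain i where i: "i \<in> J" "cmod (chirp (a i) (c i) (x n) - chirp (a i) (c i) y) \<ge> \<eta>"
      using far by blast
    have "min \<eta> 1 / 2 \<le> \<bar>sin (\<psi> i (x n) / 2)\<bar>"
      using i(2) by (simp add: chirp_def norm_cis_diff \<psi>_def)
    then have "(min \<eta> 1 / 2)\<^sup>2 \<le> \<bar>sin (\<psi> i (x n) / 2)\<bar>\<^sup>2"
      using \<eta> by (intro power_mono) auto
    then have "(cos (\<psi> i (x n) / 2))\<^sup>2 \<le> q"
      by (simp add: q_def cos_squared_eq power_divide)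
    then have "cos (\<psi> i (x n) / 2) ^ (2 * m) \<le> q ^ m"
      unfolding power_mult by (intro power_mono) auto
    moreover have "(\<Prod>j\<in>J-{i}. cos (\<psi> j (x n) / 2) ^ (2 * m)) \<le> 1"
    proof (intro prod_le_1 conjI)
      fix j
      show "0 \<le> cos (\<psi> j (x n) / 2) ^ (2 * m)" by (auto simp: power_mult)
      have "(cos (\<psi> j (x n) / 2))\<^sup>2 ^ m \<le> 1 ^ m"
        by (intro power_mono) (auto simp: abs_square_le_1)
      then show "cos (\<psi> j (x n) / 2) ^ (2 * m) \<le> 1" by (simp add: power_mult)
    qed
    ultimately have "cos (\<psi> i (x n) / 2) ^ (2 * m) * (\<Prod>j\<in>J-{i}. cos (\<psi> j (x n) / 2) ^ (2 * m)) \<le> q ^ m * 1"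
      using q by (intro mult_mono prod_nonneg) (auto simp: power_mult)
    then show ?thesis
      unfolding K_def using J i(1) by (simp add: prod.remove)
  qed
  have low: "(1 / (2 * real m)) ^ card J \<le> q ^ m" if m: "m > 0" for m
  proof -
    define P where "P = PiE J (\<lambda>_. {..2 * m})"
    define w where "w p = (\<Prod>j\<in>J. real ((2 * m) choose (p j)) / 4 ^ m)" for p :: "'j \<Rightarrow> nat"
    \<comment> \<open>The multi-index \<open>p\<close> selects one Fourier term from each factor, and \<open>(A p, C p)\<close> are the
      parameters of the resulting product chirp.\<close>
    define A where "A p = (\<Sum>j\<in>J. (real (p j) - real m) * a j)" for p :: "'j \<Rightarrow> nat"
    define C where "C p = (\<Sum>j\<in>J. (real (p j) - real m) * c j)" for p :: "'j \<Rightarrow> nat"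
    have finP: "finite P" unfolding P_def using J by (intro finite_PiE) auto
    have w_nonneg: "w p \<ge> 0" for p unfolding w_def by (intro prod_nonneg) auto
    have expand: "complex_of_real (K m t) =
        (\<Sum>p\<in>P. of_real (w p) * cnj (chirp (A p) (C p) y) * chirp (A p) (C p) t)" for t
    proof -
      have "complex_of_real (K m t) = (\<Prod>j\<in>J. \<Sum>s\<le>2*m.
          of_real (real ((2 * m) choose s) / 4 ^ m) * cis ((real s - real m) * \<psi> j t))"
        unfolding K_def of_real_prod cos_power_Fourier ..
      also have "\<dots> = (\<Sum>p\<in>P. \<Prod>j\<in>J. of_real (real ((2 * m) choose (p j)) / 4 ^ m)
            * cis ((real (p j) - real m) * \<psi> j t))"
        unfolding P_def using J by (intro prod_sum_PiE) auto
      also have "\<dots> = (\<Sum>p\<in>P. of_real (w p) * cnj (chirp (A p) (C p) y) * chirp (A p) (C p) t)"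
      proof (intro sum.cong refl)
        fix p
        have "(\<Prod>j\<in>J. cis ((real (p j) - real m) * \<psi> j t)) = cis (\<Sum>j\<in>J. (real (p j) - real m) * \<psi> j t)"
          using J by (induction rule: finite_induct) (auto simp: cis_mult)
        also have "(\<Sum>j\<in>J. (real (p j) - real m) * \<psi> j t) = (A p * t + C p * t\<^sup>2) - (A p * y + C p * y\<^sup>2)"
          unfolding A_def C_def \<psi>_def
          by (simp add: algebra_simps sum_distrib_left sum_distrib_right sum.distrib sum_subtractf)
        also have "cis \<dots> = cnj (chirp (A p) (C p) y) * chirp (A p) (C p) t"
          by (simp add: chirp_def cis_cnj cis_mult algebra_simps)
        finally show "(\<Prod>j\<in>J. of_real (real ((2 * m) choose (p j)) / 4 ^ m)
            * cis ((real (p j) - real m) * \<psi> j t)) = of_real (w p) * cnj (chirp (A p) (C p) y) * chirp (A p) (C p) t"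
          by (simp only: prod.distrib w_def of_real_prod mult.assoc)
      qed
      finally show ?thesis .
    qed
    have lim: "(\<lambda>N. complex_of_real ((\<Sum>n<N. K m (x n)) / real N)) \<longlonglongrightarrow>
        (\<Sum>p\<in>P. of_real (w p) * cnj (chirp (A p) (C p) y) * (if A p = 0 \<and> C p = 0 then 1 else 0))"
    proof -
      have "(\<lambda>N. \<Sum>p\<in>P. of_real (w p) * cnj (chirp (A p) (C p) y)
                * ((\<Sum>n<N. chirp (A p) (C p) (x n)) / of_nat N)) \<longlonglongrightarrow>
        (\<Sum>p\<in>P. of_real (w p) * cnj (chirp (A p) (C p) y) * (if A p = 0 \<and> C p = 0 then 1 else 0))"
      proof (intro tendsto_sum tendsto_mult tendsto_const)
        fix p
        show "(\<lambda>N. (\<Sum>n<N. chirp (A p) (C p) (x n)) / of_nat N) \<longlonglongrightarrow> (if A p = 0 \<and> C p = 0 then 1 else 0)"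
        proof (cases "A p = 0 \<and> C p = 0")
          case True
          have "(\<lambda>N. (\<Sum>n<N. chirp (A p) (C p) (x n)) / of_nat N) \<longlonglongrightarrow> 1"
            by (rule Lim_transform_eventually[OF tendsto_const], rule eventually_mono[OF eventually_gt_at_top[of 0]])
               (use True in auto)
          then show ?thesis using True by simp
        qed (use avg in auto)
      qed
      moreover have "complex_of_real ((\<Sum>n<N. K m (x n)) / real N) =
         (\<Sum>p\<in>P. of_real (w p) * cnj (chirp (A p) (C p) y) * ((\<Sum>n<N. chirp (A p) (C p) (x n)) / of_nat N))" for N
        unfolding of_real_divide of_real_sum expand
        by (subst sum.swap) (simp add: sum_distrib_left sum_divide_distrib)
      ultimately show ?thesis by simp
    qed
    \<comment> \<open>Where \<open>A p = C p = 0\<close> the conjugate chirp at \<open>y\<close> is \<open>1\<close>, so only non-negative weights survive.\<close>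
    have eq: "(\<Sum>p\<in>P. of_real (w p) * cnj (chirp (A p) (C p) y) * (if A p = 0 \<and> C p = 0 then 1 else 0)) =
        complex_of_real (\<Sum>p\<in>P. if A p = 0 \<and> C p = 0 then w p else 0)"
      unfolding of_real_sum by (intro sum.cong) auto
    have lim': "(\<lambda>N. (\<Sum>n<N. K m (x n)) / real N) \<longlonglongrightarrow> (\<Sum>p\<in>P. if A p = 0 \<and> C p = 0 then w p else 0)"
      using lim unfolding eq tendsto_of_real_iff .
    have "(\<Sum>p\<in>P. if A p = 0 \<and> C p = 0 then w p else 0) \<le> q ^ m"
    proof (rule LIMSEQ_le_const2[OF lim'], intro exI allI impI)
      fix N :: nat assume "N \<ge> 1"
      moreover have "(\<Sum>n<N. K m (x n)) \<le> (\<Sum>n<N. q ^ m)"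
        by (intro sum_mono K_le)
      ultimately show "(\<Sum>n<N. K m (x n)) / real N \<le> q ^ m"
        by (simp add: field_simps)
    qed
    moreover have "w (restrict (\<lambda>_. m) J) \<le> (\<Sum>p\<in>P. if A p = 0 \<and> C p = 0 then w p else 0)"
    proof -
      have "restrict (\<lambda>_. m) J \<in> P" by (auto simp: P_def)
      then have "(if A (restrict (\<lambda>_. m) J) = 0 \<and> C (restrict (\<lambda>_. m) J) = 0 then w (restrict (\<lambda>_. m) J) else 0)
         \<le> (\<Sum>p\<in>P. if A p = 0 \<and> C p = 0 then w p else 0)"
        by (rule member_le_sum) (use finP w_nonneg in auto)
      moreover have "A (restrict (\<lambda>_. m) J) = 0" "C (restrict (\<lambda>_. m) J) = 0"
        by (auto simp: A_def C_def)
      ultimately show ?thesis by simp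
    qed
    moreover have "(1 / (2 * real m)) ^ card J \<le> w (restrict (\<lambda>_. m) J)"
    proof -
      have "1 / (2 * real m) \<le> real ((2 * m) choose m) / 4 ^ m"
        using central_binomial_lower_bound[OF m] m by (simp add: field_simps)
      then have "(1 / (2 * real m)) ^ card J \<le> (real ((2 * m) choose m) / 4 ^ m) ^ card J"
        by (intro power_mono) auto
      also have "\<dots> = w (restrict (\<lambda>_. m) J)"
        by (simp add: w_def)
      finally show ?thesis .
    qed
    ultimately show ?thesis by linarith
  qed
  have "(\<lambda>m. (2 * real m) ^ card J * q ^ m) \<longlonglongrightarrow> 0"
    using q by real_asymp
  then have "eventually (\<lambda>m. (2 * real m) ^ card J * q ^ m < 1) sequentially"
    by (rule order_tendstoD) simp
  then obtain m where m: "m > 0" "(2 * real m) ^ card J * q ^ m < 1"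
    by (metis (mono_tags, lifting) eventually_conj eventually_gt_at_top eventually_happens trivial_limit_sequentially)
  have "1 \<le> (2 * real m) ^ card J * q ^ m"
    using low[OF m(1)] m(1) by (simp add: power_divide field_simps power_mult_distrib)
  with m(2) show False by simp
qed

text \<open>If \<open>f y \<noteq> 0\<close>, a chirp polynomial \<open>g\<close> close to \<open>f\<close> is bounded away from \<open>0\<close> at \<open>y\<close>, and hence
  also at some \<open>x\<^sub>n\<close> where all its chirps nearly return to their values at \<open>y\<close>. The quarter in
  the choice of \<open>\<epsilon>\<close> pays for two approximations and one recurrence error, with one part to spare.\<close>
lemma chirp_space_zero_on_equidistributed:
  fixes x :: "nat \<Rightarrow> real"
  assumes avg: "\<And>a c. (a, c) \<noteq> (0, 0) \<Longrightarrow> (\<lambda>N. (\<Sum>n<N. chirp a c (x n)) / of_nat N) \<longlonglongrightarrow> 0"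
    and f: "f \<in> linear_chirp_space" and zero: "\<And>n. f (x n) = 0"
  shows "f y = 0"
proof (rule ccontr)
  assume "f y \<noteq> 0"
  define \<epsilon> where "\<epsilon> = cmod (f y) / 4"
  have \<epsilon>: "\<epsilon> > 0" using \<open>f y \<noteq> 0\<close> by (simp add: \<epsilon>_def)
  obtain k :: nat and \<omega> c \<alpha> B where approx: "\<And>x. cmod (f x - (\<Sum>j=1..k. B j *
              exp (\<i> * complex_of_real ((\<omega> j + c j * (x - \<alpha> j)) * x)))) \<le> \<epsilon>"
    using f \<epsilon> unfolding linear_chirp_space_def by blast
  define a where "a j = \<omega> j - c j * \<alpha> j" for j :: nat
  define g where "g x = (\<Sum>j=1..k. B j * chirp (a j) (c j) x)" for x
  have fg: "cmod (f x - g x) \<le> \<epsilon>" for x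
    using approx[of x] unfolding chirp_term_eq g_def a_def .
  define S where "S = (\<Sum>j=1..k. cmod (B j)) + 1"
  have S: "S > 0" unfolding S_def by (intro add_nonneg_pos sum_nonneg) auto
  have "\<exists>n. \<forall>j\<in>{1..k}. cmod (chirp (a j) (c j) (x n) - chirp (a j) (c j) y) < \<epsilon> / S"
    using \<epsilon> S by (intro averages_recurrence[OF avg]) auto
  then obtain n where n: "\<And>j. j \<in> {1..k} \<Longrightarrow> cmod (chirp (a j) (c j) (x n) - chirp (a j) (c j) y) < \<epsilon> / S"
    by blast
  have "cmod (g (x n) - g y) = cmod (\<Sum>j=1..k. B j * (chirp (a j) (c j) (x n) - chirp (a j) (c j) y))"
    by (simp add: g_def sum_subtractf algebra_simps)
  also have "\<dots> \<le> (\<Sum>j=1..k. cmod (B j) * (\<epsilon> / S))"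
  proof (rule sum_norm_le)
    fix j assume "j \<in> {1..k}"
    then show "cmod (B j * (chirp (a j) (c j) (x n) - chirp (a j) (c j) y)) \<le> cmod (B j) * (\<epsilon> / S)"
      unfolding norm_mult by (intro mult_left_mono less_imp_le[OF n]) auto
  qed
  also have "\<dots> = (S - 1) * (\<epsilon> / S)"
    unfolding sum_distrib_right[symmetric] by (simp add: S_def)
  also have "\<dots> \<le> \<epsilon>"
    using S \<epsilon> by (simp add: field_simps)
  finally have "cmod (g (x n) - g y) \<le> \<epsilon>" .
  moreover have "cmod (g (x n)) \<le> \<epsilon>"
    using fg[of "x n"] zero[of n] by simp
  moreover have "cmod (f y) \<le> cmod (f y - g y) + cmod (g (x n) - g y) + cmod (g (x n))"
    by (smt (verit, best) norm_triangle_ineq4 norm_triangle_sub norm_minus_commute)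
  ultimately show False
    using fg[of y] \<epsilon> unfolding \<epsilon>_def by linarith
qed

section \<open>Mean values of chirps\<close>

text \<open>With \<open>\<phi>\<close> the phase, \<open>h = sin \<phi> / \<phi>'\<close> is an approximate antiderivative of \<open>cos \<phi>\<close>: its
  derivative differs from \<open>cos \<phi>\<close> by \<open>sin \<phi> \<cdot> \<phi>'' / \<phi>'\<^sup>2\<close>, which tends to \<open>0\<close> for linear and for
  quadratic phases alike. By l'Hopital's rule the integral is \<open>h(T) + o(T)\<close>, and
  \<open>h(T) = o(T)\<close>.\<close>
lemma cos_quadratic_mean_tendsto_0:
  fixes a c \<theta> :: real
  assumes ac: "(a, c) \<noteq> (0, 0)"
  shows "((\<lambda>T. integral {0..T} (\<lambda>x. cos (a * x + c * x\<^sup>2 + \<theta>)) / T) \<longlongrightarrow> 0) at_top"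
proof -
  define \<phi> where "\<phi> x = a * x + c * x\<^sup>2 + \<theta>" for x
  define h where "h x = sin (\<phi> x) / (a + 2 * c * x)" for x
  have nz: "eventually (\<lambda>x. a + 2 * c * x \<noteq> 0) at_top"
  proof (cases "c = 0")
    case False
    have "a + 2 * c * x \<noteq> 0" if "x > - a / (2 * c)" for x
    proof
      assume "a + 2 * c * x = 0"
      then have "x = - a / (2 * c)"
        using False by (simp add: field_simps)
      then show False using that by simp
    qed
    then show ?thesis
      by (rule eventually_mono[OF eventually_gt_at_top])
  qed (use ac in auto)
  have r: "((\<lambda>x. 2 * c / (a + 2 * c * x)\<^sup>2) \<longlongrightarrow> 0) at_top"
  proof (cases "c = 0")
    case False
    then consider "c > 0" | "c < 0" by linarith
    then show ?thesis by cases real_asymp+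
  qed auto
  have s: "((\<lambda>x. 1 / ((a + 2 * c * x) * x)) \<longlongrightarrow> 0) at_top"
  proof (cases "c = 0")
    case False
    then consider "c > 0" | "c < 0" by linarith
    then show ?thesis by cases real_asymp+
  next
    case True
    then have "a > 0 \<or> a < 0" using ac by auto
    then show ?thesis using True by (auto; real_asymp)
  qed
  have D1: "((\<lambda>T. integral {0..T} (\<lambda>x. cos (\<phi> x))) has_real_derivative cos (\<phi> x)) (at x)" if "x > 0" for x
  proof -
    have "continuous_on {0..x+1} (\<lambda>x. cos (\<phi> x))"
      unfolding \<phi>_def by (intro continuous_intros)
    then have "((\<lambda>T. integral {0..T} (\<lambda>x. cos (\<phi> x))) has_real_derivative cos (\<phi> x)) (at x within {0..x+1})"
      using that by (intro integral_has_real_derivative) auto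
    moreover have "at x within {0..x+1} = at x"
      using that by (intro at_within_interior) auto
    ultimately show ?thesis by simp
  qed
  have "((\<lambda>T. (integral {0..T} (\<lambda>x. cos (\<phi> x)) - h T) / T) \<longlongrightarrow> 0) at_top"
  proof (rule lhospital_at_top_at_top[where g' = "\<lambda>_. 1" and f' = "\<lambda>x. sin (\<phi> x) * (2 * c / (a + 2 * c * x)\<^sup>2)"])
    show "eventually (\<lambda>x. ((\<lambda>T. integral {0..T} (\<lambda>x. cos (\<phi> x)) - h T)
        has_real_derivative sin (\<phi> x) * (2 * c / (a + 2 * c * x)\<^sup>2)) (at x)) at_top"
      using nz eventually_gt_at_top[of 0]
    proof eventually_elim
      case (elim x)
      have "(h has_real_derivative (cos (\<phi> x) - sin (\<phi> x) * (2 * c / (a + 2 * c * x)\<^sup>2))) (at x)"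
      proof -
        have "(\<phi> has_real_derivative a + 2 * c * x) (at x)"
          unfolding \<phi>_def by (auto intro!: derivative_eq_intros)
        moreover have "((\<lambda>x. a + 2 * c * x) has_real_derivative 2 * c) (at x)"
          by (auto intro!: derivative_eq_intros)
        ultimately have "(h has_real_derivative (cos (\<phi> x) * (a + 2 * c * x) * (a + 2 * c * x) - sin (\<phi> x) * (2 * c))
            / ((a + 2 * c * x) * (a + 2 * c * x))) (at x)"
          unfolding h_def using elim(1) by (intro DERIV_divide DERIV_fun_sin)
        then show ?thesis
          using elim(1) by (simp add: diff_divide_distrib power2_eq_square)
      qed
      from DERIV_diff[OF D1[OF elim(2)] this] show ?case by simp
    qed
    have "((\<lambda>x. sin (\<phi> x) * (2 * c / (a + 2 * c * x)\<^sup>2)) \<longlongrightarrow> 0) at_top"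
    proof (rule Lim_null_comparison[OF _ tendsto_rabs_zero[OF r]], intro always_eventually allI)
      fix x
      have "\<bar>sin (\<phi> x)\<bar> * \<bar>2 * c / (a + 2 * c * x)\<^sup>2\<bar> \<le> 1 * \<bar>2 * c / (a + 2 * c * x)\<^sup>2\<bar>"
        by (intro mult_right_mono) auto
      then show "norm (sin (\<phi> x) * (2 * c / (a + 2 * c * x)\<^sup>2)) \<le> \<bar>2 * c / (a + 2 * c * x)\<^sup>2\<bar>"
        unfolding real_norm_def abs_mult[of "sin (\<phi> x)"] by simp
    qed
    then show "((\<lambda>x. sin (\<phi> x) * (2 * c / (a + 2 * c * x)\<^sup>2) / 1) \<longlongrightarrow> 0) at_top" by simp
  qed (auto intro: filterlim_ident)
  moreover have "((\<lambda>T. h T / T) \<longlongrightarrow> 0) at_top"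
  proof (rule Lim_null_comparison[OF _ tendsto_rabs_zero[OF s]], rule always_eventually, rule allI)
    fix T
    have "\<bar>sin (\<phi> T)\<bar> * \<bar>1 / ((a + 2 * c * T) * T)\<bar> \<le> 1 * \<bar>1 / ((a + 2 * c * T) * T)\<bar>"
      by (intro mult_right_mono) auto
    then show "norm (h T / T) \<le> \<bar>1 / ((a + 2 * c * T) * T)\<bar>"
      by (simp add: h_def abs_mult divide_inverse mult.assoc)
  qed
  ultimately have "((\<lambda>T. (integral {0..T} (\<lambda>x. cos (\<phi> x)) - h T) / T + h T / T) \<longlongrightarrow> 0 + 0) at_top"
    by (rule tendsto_add)
  then show ?thesis by (simp add: \<phi>_def diff_divide_distrib)
qed

text \<open>Both components are shifted cosines, so a single real mean value statement with a free
  phase \<open>\<theta>\<close> covers them; the vacuous shift \<open>0\<close> is written out to match it.\<close>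
lemma chirp_eq_cos: "chirp a c x = Complex (cos (a * x + c * x\<^sup>2 + 0)) (cos (a * x + c * x\<^sup>2 + - pi / 2))"
proof -
  have "sin u = cos (u + - pi / 2)" for u :: real
    by (simp add: cos_diff)
  then show ?thesis
    unfolding chirp_def by (simp only: complex_eq_iff cis.sel complex.sel add_0_right)
qed

lemma chirp_mean_tendsto_0:
  assumes ac: "(a, c) \<noteq> (0, 0)"
  shows "((\<lambda>T. integral {0..T} (chirp a c) / of_real T) \<longlongrightarrow> 0) at_top"
proof -
  have int: "chirp a c integrable_on {0..T}" for T
    by (intro integrable_continuous_interval continuous_on_chirp)
  have "((\<lambda>T. Complex (integral {0..T} (\<lambda>x. cos (a * x + c * x\<^sup>2 + 0)) / T)
      (integral {0..T} (\<lambda>x. cos (a * x + c * x\<^sup>2 + - pi / 2)) / T)) \<longlongrightarrow> Complex 0 0) at_top"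
    by (intro tendsto_Complex cos_quadratic_mean_tendsto_0[OF ac])
  moreover have "integral {0..T} (chirp a c) / of_real T = Complex (integral {0..T} (\<lambda>x. cos (a * x + c * x\<^sup>2 + 0)) / T)
      (integral {0..T} (\<lambda>x. cos (a * x + c * x\<^sup>2 + - pi / 2)) / T)" for T
    using has_integral_Re[OF integrable_integral[OF int[of T]]] has_integral_Im[OF integrable_integral[OF int[of T]]]
    by (simp add: complex_eq_iff chirp_eq_cos integral_unique)
  ultimately show ?thesis by (simp add: zero_complex.code)
qed

lemma (in prob_space) expectation_chirp_uniform:
  fixes X :: "'a \<Rightarrow> real"
  assumes lam: "lam > 0" and X [measurable]: "X \<in> borel_measurable M"
    and distr: "distr M borel X = uniform_measure lborel {0..lam}"
  shows "expectation (\<lambda>w. chirp a c (s + X w)) = integral {s..s + lam} (chirp a c) / of_real lam"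
proof -
  have "expectation (\<lambda>w. chirp a c (s + X w)) = (\<integral>x. chirp a c (s + x) \<partial>distr M borel X)"
    by (subst integral_distr) auto
  also have "\<dots> = (\<integral>x. chirp a c (s + x) \<partial>uniform_measure lborel {0..lam})"
    by (simp add: distr)
  also have "uniform_measure lborel {0..lam} = density lborel (\<lambda>x. ennreal (indicator {0..lam} x / lam))"
    unfolding uniform_measure_def using lam
    by (intro density_cong) (auto simp: divide_ennreal split: split_indicator simp flip: ennreal_1)
  also have "(\<integral>x. chirp a c (s + x) \<partial>\<dots>) = (\<integral>x. (indicator {0..lam} x / lam) *\<^sub>R chirp a c (s + x) \<partial>lborel)"
    using lam by (intro integral_density) auto
  also have "\<dots> = (LINT x:{0..lam}|lborel. chirp a c (s + x)) / of_real lam"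
    unfolding set_lebesgue_integral_def
    by (simp add: scaleR_conv_of_real divide_inverse mult.commute mult.left_commute flip: integral_mult_right_zero)
  also have "(LINT x:{0..lam}|lborel. chirp a c (s + x)) = integral {0..lam} (\<lambda>x. chirp a c (s + x))"
  proof (intro set_borel_integral_eq_integral)
    show "set_integrable lborel {0..lam} (\<lambda>x. chirp a c (s + x))"
      by (intro borel_integrable_atLeastAtMost' continuous_on_compose2[OF continuous_on_chirp[of UNIV]] continuous_intros) auto
  qed
  also have "\<dots> = integral {s..s + lam} (chirp a c)"
    using integral_shift_real_ivl[of s s "s + lam" "chirp a c"]
    by (simp add: add.commute)
  finally show ?thesis .
qed

lemma sum_integral_consecutive:
  fixes f :: "real \<Rightarrow> 'b :: banach"
  assumes "lam > 0" and f: "continuous_on UNIV f"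
  shows "(\<Sum>n<N. integral {real n * lam..real n * lam + lam} f) = integral {0..real N * lam} f"
proof (induction N)
  case (Suc N)
  have "integral {0..real N * lam} f + integral {real N * lam..real N * lam + lam} f
     = integral {0..real N * lam + lam} f"
    by (intro Henstock_Kurzweil_Integration.integral_combine integrable_continuous_interval continuous_on_subset[OF f]) (use assms in auto)
  with Suc show ?case by (simp add: algebra_simps)
qed simp

section \<open>A law of large numbers uniform over all chirps\<close>

text \<open>The mesh \<open>N\<^sup>-\<^sup>3\<close> is fine enough because a chirp changes by at most
  \<open>\<delta> (\<bar>x\<bar> + x\<^sup>2)\<close> when its parameters move by \<open>\<delta>\<close>, which is \<open>O(1/N)\<close> for \<open>\<bar>x\<bar> = O(N)\<close> and
  \<open>\<delta> = N\<^sup>-\<^sup>3\<close>. The square covered by the grid has half-width \<open>N\<close>, so every parameter pair is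
  eventually within its reach.\<close>
definition parameter_grid :: "nat \<Rightarrow> (real \<times> real) set" where
  "parameter_grid N = (\<lambda>(p, q). (of_int p / real N ^ 3, of_int q / real N ^ 3)) `
     ({- int (N ^ 4)..int (N ^ 4)} \<times> {- int (N ^ 4)..int (N ^ 4)})"

lemma finite_parameter_grid: "finite (parameter_grid N)"
  by (simp add: parameter_grid_def)

lemma card_parameter_grid_le: "real (card (parameter_grid N)) \<le> (2 * real N ^ 4 + 1)\<^sup>2"
proof -
  have "card (parameter_grid N) \<le> card ({- int (N ^ 4)..int (N ^ 4)} \<times> {- int (N ^ 4)..int (N ^ 4)})"
    unfolding parameter_grid_def by (intro card_image_le) simp
  also have "card {- int (N ^ 4)..int (N ^ 4)} = 2 * N ^ 4 + 1"
    unfolding card_atLeastAtMost_int by linarith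
  then have "card ({- int (N ^ 4)..int (N ^ 4)} \<times> {- int (N ^ 4)..int (N ^ 4)}) = (2 * N ^ 4 + 1)\<^sup>2"
    by (simp only: card_cartesian_product power2_eq_square)
  finally have "real (card (parameter_grid N)) \<le> real ((2 * N ^ 4 + 1)\<^sup>2)"
    by (rule of_nat_mono)
  then show ?thesis by (simp add: add.commute)
qed

lemma parameter_grid_approx:
  assumes N: "N > 0" and ac: "\<bar>a\<bar> \<le> real N" "\<bar>c\<bar> \<le> real N"
  shows "\<exists>(a', c') \<in> parameter_grid N. \<bar>a - a'\<bar> \<le> 1 / real N ^ 3 \<and> \<bar>c - c'\<bar> \<le> 1 / real N ^ 3"
proof -
  have approx: "\<bar>t - of_int \<lfloor>t * real N ^ 3\<rfloor> / real N ^ 3\<bar> \<le> 1 / real N ^ 3" for t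
  proof -
    have "t - of_int \<lfloor>t * real N ^ 3\<rfloor> / real N ^ 3 = frac (t * real N ^ 3) / real N ^ 3"
      using N by (simp add: frac_def field_simps)
    moreover have "0 \<le> frac (t * real N ^ 3)" "frac (t * real N ^ 3) \<le> 1"
      by (auto intro: less_imp_le[OF frac_lt_1])
    ultimately show ?thesis by (simp add: divide_right_mono)
  qed
  have range: "\<lfloor>t * real N ^ 3\<rfloor> \<in> {- int (N ^ 4)..int (N ^ 4)}" if "\<bar>t\<bar> \<le> real N" for t
  proof -
    have "\<bar>t * real N ^ 3\<bar> \<le> real N * real N ^ 3"
      using that by (simp add: abs_mult mult_right_mono)
    then have "- real (N ^ 4) \<le> t * real N ^ 3" "t * real N ^ 3 \<le> real (N ^ 4)"
      by (auto simp: abs_le_iff eval_nat_numeral)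
    then show ?thesis by (simp add: le_floor_iff floor_le_iff)
  qed
  have "(of_int \<lfloor>a * real N ^ 3\<rfloor> / real N ^ 3, of_int \<lfloor>c * real N ^ 3\<rfloor> / real N ^ 3) \<in> parameter_grid N"
    unfolding parameter_grid_def using range[OF ac(1)] range[OF ac(2)]
    by (intro image_eqI[of _ _ "(\<lfloor>a * real N ^ 3\<rfloor>, \<lfloor>c * real N ^ 3\<rfloor>)"]) auto
  with approx[of a] approx[of c] show ?thesis by blast
qed


context prob_space
begin

lemma indep_sets_reindex:
  assumes indep: "indep_sets F (f ` I)" and inj: "inj_on f I"
  shows "indep_sets (\<lambda>i. F (f i)) I"
proof (rule indep_setsI)
  show "F (f i) \<subseteq> events" if "i \<in> I" for i
    using indep that by (auto simp: indep_sets_def)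
  fix A J assume J: "J \<noteq> {}" "J \<subseteq> I" "finite J" "\<forall>j\<in>J. A j \<in> F (f j)"
  have inj_J: "inj_on f J" using inj J(2) by (rule inj_on_subset)
  define A' where "A' k = A (the_inv_into J f k)" for k
  have A': "A' (f j) = A j" if "j \<in> J" for j
    using that by (simp add: A'_def the_inv_into_f_f[OF inj_J])
  have "prob (\<Inter>k\<in>f ` J. A' k) = (\<Prod>k\<in>f ` J. prob (A' k))"
    using J A' by (intro indep_setsD[OF indep]) auto
  then show "prob (\<Inter>j\<in>J. A j) = (\<Prod>j\<in>J. prob (A j))"
    using A' by (simp add: prod.reindex[OF inj_J])
qed

lemma indep_vars_reindex:
  assumes "indep_vars M' X (f ` I)" and "inj_on f I"
  shows "indep_vars (\<lambda>i. M' (f i)) (\<lambda>i. X (f i)) I"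
  using assms indep_sets_reindex[of _ f I] unfolding indep_vars_def2 by auto

text \<open>The exponential decay in \<open>N\<close> is what matters here: it outweighs a number of
  parameters growing polynomially in \<open>N\<close>.\<close>
lemma Hoeffding_bounded_transform:
  fixes Z :: "nat \<Rightarrow> 'a \<Rightarrow> real" and u :: "real \<Rightarrow> real"
  assumes indep: "indep_vars (\<lambda>_. borel) Z UNIV"
    and u [measurable]: "u \<in> borel_measurable borel" and bound: "\<And>x. \<bar>u x\<bar> \<le> 1"
    and \<epsilon>: "\<epsilon> \<ge> 0"
  shows "prob {w \<in> space M. \<bar>\<Sum>n<N. u (Z n w) - expectation (\<lambda>w. u (Z n w))\<bar> \<ge> \<epsilon> * real N}
           \<le> 2 * exp (- \<epsilon>\<^sup>2 * real N / 2)"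
proof (cases "N = 0")
  case True
  have "prob A \<le> 2" for A using prob_le_1[of A] by linarith
  then show ?thesis using True by simp
next
  case False
  have indep': "indep_vars (\<lambda>_. borel) (\<lambda>n w. u (Z n w)) {..<N}"
    by (rule indep_vars_compose2[OF indep_vars_subset[OF indep]]) auto
  interpret Hoeffding_ineq M "{..<N}" "\<lambda>n w. u (Z n w)" "\<lambda>_. -1" "\<lambda>_. 1" "\<Sum>n<N. expectation (\<lambda>w. u (Z n w))"
  proof unfold_locales
    fix n assume "n \<in> {..<N}"
    have "u (Z n w) \<in> {-1..1}" for w
      using bound[of "Z n w"] by (auto simp: abs_le_iff)
    then show "AE w in M. u (Z n w) \<in> {-1..1}" by simp
  qed (use indep' in simp_all)
  have "prob {w \<in> space M. \<bar>(\<Sum>n<N. u (Z n w)) - (\<Sum>n<N. expectation (\<lambda>w. u (Z n w)))\<bar> \<ge> \<epsilon> * real N}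
      \<le> 2 * exp (- 2 * (\<epsilon> * real N)\<^sup>2 / (\<Sum>n<N. (1 - (- 1))\<^sup>2))"
    by (rule Hoeffding_ineq_abs_ge) (use \<epsilon> False in auto)
  also have "- 2 * (\<epsilon> * real N)\<^sup>2 / (\<Sum>n<N. (1 - (- 1))\<^sup>2) = - \<epsilon>\<^sup>2 * real N / 2"
    using False by (simp add: power2_eq_square)
  finally show ?thesis by (simp add: sum_subtractf)
qed

definition chirp_deviation :: "(nat \<Rightarrow> 'a \<Rightarrow> real) \<Rightarrow> nat \<Rightarrow> real \<Rightarrow> real \<Rightarrow> 'a \<Rightarrow> complex" where
  "chirp_deviation Z N a c w = (\<Sum>n<N. chirp a c (Z n w) - expectation (\<lambda>w. chirp a c (Z n w)))"

lemma integrable_chirp: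
  fixes Z :: "'a \<Rightarrow> real"
  assumes [measurable]: "Z \<in> borel_measurable M"
  shows "integrable M (\<lambda>w. chirp a c (Z w))"
  by (rule integrable_const_bound[of _ 1]) auto

text \<open>A complex number of modulus at least \<open>2\<epsilon>N\<close> has real or imaginary part at least \<open>\<epsilon>N\<close> in
  absolute value, and each part is controlled by the real inequality.\<close>
lemma prob_chirp_deviation:
  fixes Z :: "nat \<Rightarrow> 'a \<Rightarrow> real"
  assumes indep: "indep_vars (\<lambda>_. borel) Z UNIV" and \<epsilon>: "\<epsilon> \<ge> 0"
  shows "prob {w \<in> space M. cmod (chirp_deviation Z N a c w) \<ge> 2 * \<epsilon> * real N} \<le> 4 * exp (- \<epsilon>\<^sup>2 * real N / 2)"
proof -
  have Z [measurable]: "Z n \<in> borel_measurable M" for n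
    using indep unfolding indep_vars_def by auto
  define ev where "ev u = {w \<in> space M. \<bar>\<Sum>n<N. u (Z n w) - expectation (\<lambda>w. u (Z n w))\<bar> \<ge> \<epsilon> * real N}"
    for u :: "real \<Rightarrow> real"
  have ev [measurable]: "ev u \<in> events" if [measurable]: "u \<in> borel_measurable borel" for u
    unfolding ev_def by measurable
  have "{w \<in> space M. cmod (chirp_deviation Z N a c w) \<ge> 2 * \<epsilon> * real N}
      \<subseteq> ev (\<lambda>x. Re (chirp a c x)) \<union> ev (\<lambda>x. Im (chirp a c x))"
  proof
    fix w assume "w \<in> {w \<in> space M. cmod (chirp_deviation Z N a c w) \<ge> 2 * \<epsilon> * real N}"
    then have w: "w \<in> space M" "2 * \<epsilon> * real N \<le> \<bar>Re (chirp_deviation Z N a c w)\<bar> + \<bar>Im (chirp_deviation Z N a c w)\<bar>"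
      using cmod_le[of "chirp_deviation Z N a c w"] by auto
    then show "w \<in> ev (\<lambda>x. Re (chirp a c x)) \<union> ev (\<lambda>x. Im (chirp a c x))"
      by (auto simp: ev_def chirp_deviation_def integrable_chirp)
  qed
  then have "prob {w \<in> space M. cmod (chirp_deviation Z N a c w) \<ge> 2 * \<epsilon> * real N}
      \<le> prob (ev (\<lambda>x. Re (chirp a c x)) \<union> ev (\<lambda>x. Im (chirp a c x)))"
    by (intro finite_measure_mono) measurable
  also have "\<dots> \<le> prob (ev (\<lambda>x. Re (chirp a c x))) + prob (ev (\<lambda>x. Im (chirp a c x)))"
    by (intro measure_Un_le) measurable
  also have "\<dots> \<le> 2 * exp (- \<epsilon>\<^sup>2 * real N / 2) + 2 * exp (- \<epsilon>\<^sup>2 * real N / 2)"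
    unfolding ev_def
    by (intro add_mono Hoeffding_bounded_transform[OF indep _ _ \<epsilon>])
       (auto intro: order_trans[OF abs_Re_le_cmod] order_trans[OF abs_Im_le_cmod])
  finally show ?thesis by simp
qed

lemma chirp_deviation_diff_le:
  fixes Z :: "nat \<Rightarrow> 'a \<Rightarrow> real"
  assumes Z [measurable]: "\<And>n. Z n \<in> borel_measurable M"
    and bound: "\<And>n. AE w in M. \<bar>Z n w\<bar> \<le> C * (real n + 1)" and C: "C \<ge> 0"
    and w: "\<And>n. \<bar>Z n w\<bar> \<le> C * (real n + 1)"
    and d: "\<bar>a - a'\<bar> \<le> \<delta>" "\<bar>c - c'\<bar> \<le> \<delta>"
  shows "cmod (chirp_deviation Z N a c w - chirp_deviation Z N a' c' w)
           \<le> real N * (2 * \<delta> * (C * real N + (C * real N)\<^sup>2))"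
proof -
  define B where "B = \<delta> * (C * real N + (C * real N)\<^sup>2)"
  have \<delta>: "\<delta> \<ge> 0" using d by linarith
  have pw: "cmod (chirp a c z - chirp a' c' z) \<le> B" if "n < N" "\<bar>z\<bar> \<le> C * (real n + 1)" for z n
  proof -
    have "C * (real n + 1) \<le> C * real N"
      using that C by (intro mult_left_mono) auto
    with that have z: "\<bar>z\<bar> \<le> C * real N" by linarith
    then have z2: "z\<^sup>2 \<le> (C * real N)\<^sup>2"
      using abs_le_square_iff[of z "C * real N"] C by simp
    have "cmod (chirp a c z - chirp a' c' z) \<le> \<bar>a - a'\<bar> * \<bar>z\<bar> + \<bar>c - c'\<bar> * z\<^sup>2"
      by (rule norm_chirp_diff_le)
    also have "\<dots> \<le> \<delta> * (C * real N) + \<delta> * (C * real N)\<^sup>2"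
      using d z z2 \<delta> by (intro add_mono mult_mono) auto
    finally show ?thesis by (simp add: B_def distrib_left)
  qed
  have ex: "cmod (expectation (\<lambda>w. chirp a c (Z n w)) - expectation (\<lambda>w. chirp a' c' (Z n w))) \<le> B"
    if "n < N" for n
  proof -
    have "expectation (\<lambda>w. chirp a c (Z n w)) - expectation (\<lambda>w. chirp a' c' (Z n w))
        = expectation (\<lambda>w. chirp a c (Z n w) - chirp a' c' (Z n w))"
      by (simp add: integrable_chirp)
    also have "cmod \<dots> \<le> expectation (\<lambda>w. cmod (chirp a c (Z n w) - chirp a' c' (Z n w)))"
      by (rule integral_norm_bound)
    also have "\<dots> \<le> B"
      by (intro integral_le_const integrable_norm Bochner_Integration.integrable_diff integrable_chirp Z
            eventually_mono[OF bound[of n]] pw[OF that])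
    finally show ?thesis .
  qed
  have "chirp_deviation Z N a c w - chirp_deviation Z N a' c' w =
      (\<Sum>n<N. (chirp a c (Z n w) - chirp a' c' (Z n w)) -
         (expectation (\<lambda>w. chirp a c (Z n w)) - expectation (\<lambda>w. chirp a' c' (Z n w))))"
    by (simp add: chirp_deviation_def flip: sum_subtractf) (simp add: algebra_simps)
  also have "cmod \<dots> \<le> (\<Sum>n<N. B + B)"
    by (intro sum_norm_le order_trans[OF norm_triangle_ineq4] add_mono pw ex) (use w in auto)
  finally show ?thesis by (simp add: B_def)
qed

text \<open>A union bound over the grid, with Hoeffding's inequality at each of its \<open>O(N\<^sup>8)\<close> points,
  gives summable probabilities; Borel--Cantelli does the rest.\<close>
lemma AE_chirp_deviation_grid:
  fixes Z :: "nat \<Rightarrow> 'a \<Rightarrow> real"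
  assumes indep: "indep_vars (\<lambda>_. borel) Z UNIV" and \<epsilon>: "\<epsilon> > 0"
  shows "AE w in M. eventually (\<lambda>N. \<forall>(a, c)\<in>parameter_grid N.
           cmod (chirp_deviation Z N a c w) < 2 * \<epsilon> * real N) sequentially"
proof -
  have Z [measurable]: "Z n \<in> borel_measurable M" for n
    using indep unfolding indep_vars_def by auto
  define E where "E N g = {w \<in> space M. cmod (chirp_deviation Z N (fst g) (snd g) w) \<ge> 2 * \<epsilon> * real N}"
    for N and g :: "real \<times> real"
  have E [measurable]: "E N g \<in> events" for N g
    unfolding E_def chirp_deviation_def by measurable
  define A where "A N = (\<Union>g\<in>parameter_grid N. E N g)" for N
  have A [measurable]: "A N \<in> events" for N
    unfolding A_def by (intro sets.finite_UN finite_parameter_grid E)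
  have le: "prob (A N) \<le> (2 * real N ^ 4 + 1)\<^sup>2 * (4 * exp (- \<epsilon>\<^sup>2 * real N / 2))" for N
  proof -
    have "prob (A N) \<le> (\<Sum>g\<in>parameter_grid N. prob (E N g))"
      unfolding A_def by (intro finite_measure_subadditive_finite finite_parameter_grid) auto
    also have "\<dots> \<le> (\<Sum>g\<in>parameter_grid N. 4 * exp (- \<epsilon>\<^sup>2 * real N / 2))"
      unfolding E_def using \<epsilon> by (intro sum_mono prob_chirp_deviation[OF indep]) auto
    also have "\<dots> = real (card (parameter_grid N)) * (4 * exp (- \<epsilon>\<^sup>2 * real N / 2))"
      by simp
    also have "\<dots> \<le> (2 * real N ^ 4 + 1)\<^sup>2 * (4 * exp (- \<epsilon>\<^sup>2 * real N / 2))"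
      by (intro mult_right_mono card_parameter_grid_le) auto
    finally show ?thesis .
  qed
  have "summable (\<lambda>N. (2 * real N ^ 4 + 1)\<^sup>2 * (4 * exp (- \<epsilon>\<^sup>2 * real N / 2)))"
  proof (rule summable_comparison_test_bigo)
    show "summable (\<lambda>N. norm (inverse (real N ^ 2)))"
      using inverse_power_summable[of 2, where 'a = real] by simp
    show "(\<lambda>N. (2 * real N ^ 4 + 1)\<^sup>2 * (4 * exp (- \<epsilon>\<^sup>2 * real N / 2))) \<in> O(\<lambda>N. inverse (real N ^ 2))"
      using \<epsilon> by real_asymp
  qed
  then have "summable (\<lambda>N. prob (A N))"
    by (rule summable_comparison_test'[where N = 0]) (use le in auto)
  then have "AE w in M. eventually (\<lambda>N. w \<in> space M - A N) sequentially"
    by (intro borel_cantelli_AE1) (auto simp: emeasure_eq_measure)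
  then show ?thesis
  proof eventually_elim
    case (elim w)
    then show ?case
      by eventually_elim (auto simp: A_def E_def not_le)
  qed
qed

text \<open>The strong law of large numbers for chirps of all parameters at once. The exceptional null
  set must not depend on the uncountably many parameters, since the frequencies of a function
  in the chirp space may be chosen after the configuration is known.\<close>
lemma AE_chirp_deviation_tendsto_0:
  fixes Z :: "nat \<Rightarrow> 'a \<Rightarrow> real"
  assumes indep: "indep_vars (\<lambda>_. borel) Z UNIV"
    and bound: "\<And>n. AE w in M. \<bar>Z n w\<bar> \<le> C * (real n + 1)" and C: "C \<ge> 0"
  shows "AE w in M. \<forall>a c. (\<lambda>N. chirp_deviation Z N a c w / of_nat N) \<longlonglongrightarrow> 0"
proof -
  have Z [measurable]: "Z n \<in> borel_measurable M" for n
    using indep unfolding indep_vars_def by auto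
  have "AE w in M. \<forall>r. eventually (\<lambda>N. \<forall>(a, c)\<in>parameter_grid N.
           cmod (chirp_deviation Z N a c w) < 2 * (1 / real (Suc r)) * real N) sequentially"
    unfolding AE_all_countable by (intro allI AE_chirp_deviation_grid[OF indep]) simp
  moreover have "AE w in M. \<forall>n. \<bar>Z n w\<bar> \<le> C * (real n + 1)"
    unfolding AE_all_countable using bound by blast
  ultimately show ?thesis
  proof eventually_elim
    case (elim w)
    show ?case
    proof (intro allI tendstoI)
      fix a c \<epsilon> :: real assume \<epsilon>: "\<epsilon> > 0"
      obtain r where r: "1 / real (Suc r) < \<epsilon> / 4"
        using \<epsilon> by (metis divide_pos_pos nat_approx_posE zero_less_numeral)
      have "(\<lambda>N. 2 * (1 / real N ^ 3) * (C * real N + (C * real N)\<^sup>2)) \<longlonglongrightarrow> 0"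
      proof (cases "C = 0")
        case False
        then have "C > 0" using C by simp
        then show ?thesis by real_asymp
      qed simp
      then have "eventually (\<lambda>N. 2 * (1 / real N ^ 3) * (C * real N + (C * real N)\<^sup>2) < \<epsilon> / 2) sequentially"
        by (rule order_tendstoD) (use \<epsilon> in simp)
      moreover have "eventually (\<lambda>N. real N \<ge> max \<bar>a\<bar> \<bar>c\<bar>) sequentially"
        using filterlim_real_sequentially unfolding filterlim_at_top by blast
      ultimately show "eventually (\<lambda>N. dist (chirp_deviation Z N a c w / of_nat N) 0 < \<epsilon>) sequentially"
        using elim(1)[rule_format, of r] eventually_gt_at_top[of 0]
      proof eventually_elim
        case (elim N)
        obtain a' c' where g: "(a', c') \<in> parameter_grid N" "\<bar>a - a'\<bar> \<le> 1 / real N ^ 3" "\<bar>c - c'\<bar> \<le> 1 / real N ^ 3"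
          using parameter_grid_approx[of N a c] elim by auto
        have "cmod (chirp_deviation Z N a' c' w) < 2 * (1 / real (Suc r)) * real N"
          using elim(3) g(1) by blast
        also have "\<dots> \<le> real N * (\<epsilon> / 2)"
          using mult_right_mono[of "2 * (1 / real (Suc r))" "\<epsilon> / 2" "real N"] r
          by (simp add: mult.commute)
        finally have 1: "cmod (chirp_deviation Z N a' c' w) < real N * (\<epsilon> / 2)" .
        have "cmod (chirp_deviation Z N a c w - chirp_deviation Z N a' c' w)
            \<le> real N * (2 * (1 / real N ^ 3) * (C * real N + (C * real N)\<^sup>2))"
          using g by (intro chirp_deviation_diff_le[OF Z bound C]) (use \<open>\<forall>n. \<bar>Z n w\<bar> \<le> C * (real n + 1)\<close> in auto)
        also have "\<dots> < real N * (\<epsilon> / 2)"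
          using elim by (intro mult_strict_left_mono) auto
        finally have "cmod (chirp_deviation Z N a c w) < real N * (\<epsilon> / 2) + real N * (\<epsilon> / 2)"
          using 1 norm_triangle_sub[of "chirp_deviation Z N a c w" "chirp_deviation Z N a' c' w"] by linarith
        then show ?case
          using elim(4) by (simp add: norm_divide field_simps)
      qed
    qed
  qed
qed

end

section \<open>Uniqueness for randomly perturbed lattices\<close>

theorem theorem2:
  fixes M :: "'a measure" and X :: "int \<Rightarrow> 'a \<Rightarrow> real" and lam :: real
  assumes "lam > 0"
    and "prob_space M"
    and "prob_space.indep_vars M (\<lambda>_. borel) X UNIV"
    and "\<And>n. distr M borel (X n) = uniform_measure lborel {0..lam}"
  shows "AE w in M. \<forall>f\<in>linear_chirp_space.
           (\<forall>n::int. f (of_int n * lam + X n w) = 0) \<longrightarrow> (\<forall>x. f x = 0)"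
proof -
  interpret prob_space M by fact
  have X [measurable]: "X n \<in> borel_measurable M" for n
    using assms(3) unfolding indep_vars_def by auto
  define Z where "Z n w = real n * lam + X (int n) w" for n w
  have "indep_vars (\<lambda>_. borel) (\<lambda>n. X (int n)) UNIV"
    by (rule indep_vars_reindex[OF indep_vars_subset[OF assms(3)]]) auto
  then have indep: "indep_vars (\<lambda>_. borel) Z UNIV"
    unfolding Z_def by (rule indep_vars_compose2) auto
  have bound: "AE w in M. \<bar>Z n w\<bar> \<le> lam * (real n + 1)" for n
  proof -
    have "AE x in uniform_measure lborel {0..lam}. x \<in> {0..lam}"
      by (intro AE_uniform_measureI) auto
    then have "AE x in distr M borel (X (int n)). x \<in> {0..lam}"
      unfolding assms(4) .
    then have "AE w in M. X (int n) w \<in> {0..lam}"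
      by (subst (asm) AE_distr_iff) auto
    then show ?thesis
      by eventually_elim (use assms(1) in \<open>auto simp: Z_def algebra_simps\<close>)
  qed
  have means: "(\<lambda>N. (\<Sum>n<N. expectation (\<lambda>w. chirp a c (Z n w))) / of_nat N) \<longlonglongrightarrow> 0"
    if ac: "(a, c) \<noteq> (0, 0)" for a c
  proof -
    have "(\<Sum>n<N. expectation (\<lambda>w. chirp a c (Z n w))) / of_nat N
        = integral {0..real N * lam} (chirp a c) / of_real (real N * lam)" for N
    proof -
      have "(\<Sum>n<N. expectation (\<lambda>w. chirp a c (Z n w)))
          = (\<Sum>n<N. integral {real n * lam..real n * lam + lam} (chirp a c)) / of_real lam"
        unfolding Z_def expectation_chirp_uniform[OF assms(1) X assms(4)] sum_divide_distrib ..
      also have "(\<Sum>n<N. integral {real n * lam..real n * lam + lam} (chirp a c))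
          = integral {0..real N * lam} (chirp a c)"
        by (rule sum_integral_consecutive[OF assms(1) continuous_on_chirp])
      finally show ?thesis by (simp add: mult.commute)
    qed
    moreover have "filterlim (\<lambda>N. real N * lam) at_top sequentially"
      using assms(1) by real_asymp
    ultimately show ?thesis
      by (simp only: filterlim_compose[OF chirp_mean_tendsto_0[OF ac]])
  qed
  have "AE w in M. \<forall>a c. (\<lambda>N. chirp_deviation Z N a c w / of_nat N) \<longlonglongrightarrow> 0"
    using AE_chirp_deviation_tendsto_0[OF indep bound] assms(1) by simp
  then show ?thesis
  proof eventually_elim
    case (elim w)
    have avg: "(\<lambda>N. (\<Sum>n<N. chirp a c (Z n w)) / of_nat N) \<longlonglongrightarrow> 0" if "(a, c) \<noteq> (0, 0)" for a c
      using tendsto_add[OF elim[rule_format, of a c] means[OF that]]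
      by (simp add: chirp_deviation_def sum_subtractf diff_divide_distrib)
    show ?case
    proof (intro ballI impI allI)
      fix f y assume f: "f \<in> linear_chirp_space" "\<forall>n::int. f (of_int n * lam + X n w) = 0"
      have "f (Z n w) = 0" for n
        using f(2)[rule_format, of "int n"] by (simp add: Z_def)
      then show "f y = 0"
        using chirp_space_zero_on_equidistributed[OF avg f(1)] by blast
    qed
  qed
qed

end
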